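(* Let $(\mathsf X,\mathsf A,(\mathrm P^a)_{a\in\mathsf A},(r^a)_{a\in\mathsf A})$ be a Markov decision process with uniformly bounded rewards and discount factor $\gamma\in(0,1)$, let $\pi$ be a policy with value function $V^\pi$, and let $V^\star$ be the optimal value function. Put $\Phi_\pi^{x,a}(y)=V^\pi(y)-(\mathrm P^aV^\pi)(x)$ and, for bounded measurable $V_0^{\mathrm{up}}:\mathsf X\to\mathbb R$, define for $k\ge 0$ $$V_{k+1}^{\mathrm{up}}(x)=\mathsf E\Big[\max_{a\in\mathsf A}\big\{r^a(x)+\gamma\big(V_k^{\mathrm{up}}(Y^{x,a})-\Phi_\pi^{x,a}(Y^{x,a})\big)\big\}\Big],\qquad Y^{x,a}\sim\mathrm P^a(\cdot|x).$$ Then: (i) $V_k^{\mathrm{up}}$ converges as $k\to\infty$ in sup-norm to a function $V^{\mathrm{up}}$ that does not depend on $V_0^{\mathrm{up}}$. (ii) If $V_0^{\mathrm{up}}(x)\ge V^\star(x)$ for all $x\in\mathsf X$, then $V^\pi(x)\le V^\star(x)\le V_k^{\mathrm{up}}(x)$ for all $k\in\mathbb N$ and $x\in\mathsf X$. (iii) For all $k\in\mathbb N$, $\|V_{k+1}^{\mathrm{up}}-V^\star\|_{\mathsf X}\le\gamma\|V_k^{\mathrm{up}}-V^\star\|_{\mathsf X}+2\gamma\|V^\pi-V^\star\|_{\mathsf X}$. (iv) With $\Delta_\pi=V^\star-V^\pi$ and $\Delta_\pi^{\mathrm{up}}=\lim_{k\to\infty}(V_k^{\mathrm{up}}-V^\pi)$,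 $$\|\Delta_\pi\|_{\mathsf X}\le\|\Delta_\pi^{\mathrm{up}}\|_{\mathsf X}\le\Big(1+\frac{2\gamma}{1-\gamma}\Big)\|V^\star-V^\pi\|_{\mathsf X};$$ in particular $\Delta_\pi^{\mathrm{up}}=0$ if $\pi$ is an optimal policy.
   Context: $\mathrm P^a(\cdot|x)$ is the transition kernel under action $a$, $r^a:\mathsf X\to\mathbb R$ the reward, $\mathrm P^aV(x)=\int V(y)\,\mathrm P^a(dy|x)$, $\|f\|_{\mathsf X}=\sup_{x\in\mathsf X}|f(x)|$. $V^\pi(x)=\mathsf E[\sum_{t\ge0}\gamma^tr^{A_t}(X_t)\mid X_0=x]$ where actions are chosen by $\pi$. The optimal value function $V^\star$ is the pointwise maximal value over all policies and satisfies the Bellman optimality equation $V^\star(x)=\max_a\{r^a(x)+\gamma\mathrm P^aV^\star(x)\}$. For each $x$, the random variables $(Y^{x,a})_{a\in\mathsf A}$ are defined on a common probability space with the stated marginals (their joint law is arbitrary but fixed). Maxima over $a$ are assumed to exist and the resulting functions to be measurable. *)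

theory Defs
  imports "HOL-Probability.Probability"
begin

record ('x, 'a) mdp =
  states :: "'x measure"
  actions :: "'a measure"
  trans :: "'a \<Rightarrow> 'x \<Rightarrow> 'x measure"
  rew :: "'a \<Rightarrow> 'x \<Rightarrow> real"

abbreviation state_set :: "('x, 'a) mdp \<Rightarrow> 'x set" where
  "state_set M \<equiv> space (states M)"

abbreviation action_set :: "('x, 'a) mdp \<Rightarrow> 'a set" where
  "action_set M \<equiv> space (actions M)"

abbreviation sa_space :: "('x, 'a) mdp \<Rightarrow> ('x \<times> 'a) measure" where
  "sa_space M \<equiv> states M \<Otimes>\<^sub>M actions M"

text \<open>Joint measurability in state and action is what makes the law of the controlled process
  well defined; it is automatic when the actions are countable and carry the discrete sigma-algebra.\<close>

definition is_mdp :: "('x, 'a) mdp \<Rightarrow> bool" where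
  "is_mdp M \<longleftrightarrow>
     state_set M \<noteq> {} \<and> action_set M \<noteq> {} \<and>
     (\<lambda>(x, a). trans M a x) \<in> sa_space M \<rightarrow>\<^sub>M prob_algebra (states M) \<and>
     (\<lambda>(x, a). rew M a x) \<in> borel_measurable (sa_space M)"

definition bounded_rewards :: "('x, 'a) mdp \<Rightarrow> bool" where
  "bounded_rewards M \<longleftrightarrow>
     (\<exists>R. \<forall>a\<in>action_set M. \<forall>x\<in>state_set M. \<bar>rew M a x\<bar> \<le> R)"

text \<open>Policies are randomized and history dependent: at time \<open>t\<close> the action is drawn from
  \<open>\<pi> t (h, x)\<close>, where \<open>h\<close> lists the state-action pairs at times \<open>0, \<dots>, t - 1\<close> and \<open>x\<close> is the
  current state.\<close>

type_synonym ('x, 'a) policy = "nat \<Rightarrow> (nat \<Rightarrow> 'x \<times> 'a) \<times> 'x \<Rightarrow> 'a measure"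

definition policies :: "('x, 'a) mdp \<Rightarrow> ('x, 'a) policy set" where
  "policies M =
     {\<pi>. \<forall>t. \<pi> t \<in> PiM {0..<t} (\<lambda>_. sa_space M) \<Otimes>\<^sub>M states M
               \<rightarrow>\<^sub>M prob_algebra (actions M)}"

text \<open>Conditional law of the pair \<open>(X\<^sub>t, A\<^sub>t)\<close> given the earlier pairs \<open>h\<close>, with \<open>X\<^sub>0 = x\<close>.\<close>

definition step_kernel ::
    "('x, 'a) mdp \<Rightarrow> ('x, 'a) policy \<Rightarrow> 'x \<Rightarrow> nat \<Rightarrow> (nat \<Rightarrow> 'x \<times> 'a) \<Rightarrow> ('x \<times> 'a) measure" where
  "step_kernel M \<pi> x t h =
     (if t = 0 then return (states M) x
      else trans M (snd (h (t - 1))) (fst (h (t - 1))))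
     \<bind> (\<lambda>y. distr (\<pi> t (h, y)) (sa_space M) (Pair y))"

text \<open>The law of \<open>(X\<^sub>t, A\<^sub>t)\<close>, \<open>t = 0, 1, \<dots>\<close>, given by the Ionescu-Tulcea theorem; see
  \<open>Ionescu_Tulcea_step_kernel\<close> below.\<close>

definition trajectory_law ::
    "('x, 'a) mdp \<Rightarrow> ('x, 'a) policy \<Rightarrow> 'x \<Rightarrow> (nat \<Rightarrow> 'x \<times> 'a) measure" where
  "trajectory_law M \<pi> x =
     projective_family.lim UNIV
       (Ionescu_Tulcea.CI (step_kernel M \<pi> x) (\<lambda>_. sa_space M)) (\<lambda>_. sa_space M)"

definition policy_value :: "('x, 'a) mdp \<Rightarrow> real \<Rightarrow> ('x, 'a) policy \<Rightarrow> 'x \<Rightarrow> real" where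
  "policy_value M \<gamma> \<pi> x =
     (\<integral>\<omega>. (\<Sum>t. \<gamma> ^ t * rew M (snd (\<omega> t)) (fst (\<omega> t))) \<partial>trajectory_law M \<pi> x)"

definition opt_value :: "('x, 'a) mdp \<Rightarrow> real \<Rightarrow> 'x \<Rightarrow> real" where
  "opt_value M \<gamma> x = (SUP \<pi>\<in>policies M. policy_value M \<gamma> \<pi> x)"

definition optimal_policy :: "('x, 'a) mdp \<Rightarrow> real \<Rightarrow> ('x, 'a) policy \<Rightarrow> bool" where
  "optimal_policy M \<gamma> \<pi> \<longleftrightarrow>
     \<pi> \<in> policies M \<and> (\<forall>x\<in>state_set M. policy_value M \<gamma> \<pi> x = opt_value M \<gamma> x)"

definition trans_op :: "('x, 'a) mdp \<Rightarrow> 'a \<Rightarrow> ('x \<Rightarrow> real) \<Rightarrow> 'x \<Rightarrow> real" where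
  "trans_op M a V x = (\<integral>y. V y \<partial>trans M a x)"

text \<open>A maximum over actions is written as a supremum over \<open>action_set M\<close> together with
  \<open>has_max\<close>, which says that the supremum is attained.\<close>

definition has_max :: "'a set \<Rightarrow> ('a \<Rightarrow> real) \<Rightarrow> bool" where
  "has_max A f \<longleftrightarrow> (\<exists>a\<in>A. \<forall>b\<in>A. f b \<le> f a)"

definition bellman_optimality :: "('x, 'a) mdp \<Rightarrow> real \<Rightarrow> ('x \<Rightarrow> real) \<Rightarrow> bool" where
  "bellman_optimality M \<gamma> V \<longleftrightarrow>
     V \<in> borel_measurable (states M) \<and>
     (\<forall>x\<in>state_set M.
        has_max (action_set M) (\<lambda>a. rew M a x + \<gamma> * trans_op M a V x) \<and>
        V x = (SUP a\<in>action_set M. rew M a x + \<gamma> * trans_op M a V x))"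

text \<open>For each state \<open>x\<close>, the variables \<open>Y x a\<close> live on one probability space \<open>\<Omega> x\<close>; only their
  marginals are prescribed.\<close>

definition next_state_variables ::
    "('x, 'a) mdp \<Rightarrow> ('x \<Rightarrow> 'w measure) \<Rightarrow> ('x \<Rightarrow> 'a \<Rightarrow> 'w \<Rightarrow> 'x) \<Rightarrow> bool" where
  "next_state_variables M \<Omega> Y \<longleftrightarrow>
     (\<forall>x\<in>state_set M. prob_space (\<Omega> x) \<and>
        (\<forall>a\<in>action_set M. Y x a \<in> \<Omega> x \<rightarrow>\<^sub>M states M \<and>
           distr (\<Omega> x) (states M) (Y x a) = trans M a x))"

definition Phi :: "('x, 'a) mdp \<Rightarrow> real \<Rightarrow> ('x, 'a) policy \<Rightarrow> 'x \<Rightarrow> 'a \<Rightarrow> 'x \<Rightarrow> real" where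
  "Phi M \<gamma> \<pi> x a y = policy_value M \<gamma> \<pi> y - trans_op M a (policy_value M \<gamma> \<pi>) x"

definition up_target ::
    "('x, 'a) mdp \<Rightarrow> real \<Rightarrow> ('x, 'a) policy \<Rightarrow> ('x \<Rightarrow> 'a \<Rightarrow> 'w \<Rightarrow> 'x) \<Rightarrow>
     ('x \<Rightarrow> real) \<Rightarrow> 'x \<Rightarrow> 'w \<Rightarrow> 'a \<Rightarrow> real" where
  "up_target M \<gamma> \<pi> Y V x w a =
     rew M a x + \<gamma> * (V (Y x a w) - Phi M \<gamma> \<pi> x a (Y x a w))"

primrec V_up ::
    "('x, 'a) mdp \<Rightarrow> real \<Rightarrow> ('x, 'a) policy \<Rightarrow> ('x \<Rightarrow> 'w measure) \<Rightarrow> ('x \<Rightarrow> 'a \<Rightarrow> 'w \<Rightarrow> 'x) \<Rightarrow>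
     ('x \<Rightarrow> real) \<Rightarrow> nat \<Rightarrow> 'x \<Rightarrow> real" where
  "V_up M \<gamma> \<pi> \<Omega> Y V0 0 = V0"
| "V_up M \<gamma> \<pi> \<Omega> Y V0 (Suc k) =
     (\<lambda>x. \<integral>w. (SUP a\<in>action_set M. up_target M \<gamma> \<pi> Y (V_up M \<gamma> \<pi> \<Omega> Y V0 k) x w a) \<partial>\<Omega> x)"

text \<open>Admissible initial functions: bounded and measurable, with the standing assumption that
  every maximum over actions occurring in the recursion started there is attained and that the
  functions produced are measurable.\<close>

definition admissible_init ::
    "('x, 'a) mdp \<Rightarrow> real \<Rightarrow> ('x, 'a) policy \<Rightarrow> ('x \<Rightarrow> 'w measure) \<Rightarrow> ('x \<Rightarrow> 'a \<Rightarrow> 'w \<Rightarrow> 'x) \<Rightarrow>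
     ('x \<Rightarrow> real) \<Rightarrow> bool" where
  "admissible_init M \<gamma> \<pi> \<Omega> Y V0 \<longleftrightarrow>
     V0 \<in> borel_measurable (states M) \<and> bounded (V0 ` state_set M) \<and>
     (\<forall>k. V_up M \<gamma> \<pi> \<Omega> Y V0 (Suc k) \<in> borel_measurable (states M) \<and>
        (\<forall>x\<in>state_set M.
           (\<forall>w\<in>space (\<Omega> x).
              has_max (action_set M) (up_target M \<gamma> \<pi> Y (V_up M \<gamma> \<pi> \<Omega> Y V0 k) x w)) \<and>
           (\<lambda>w. SUP a\<in>action_set M. up_target M \<gamma> \<pi> Y (V_up M \<gamma> \<pi> \<Omega> Y V0 k) x w a)
             \<in> borel_measurable (\<Omega> x)))"

text \<open>Meaningful for functions that are bounded on \<open>X\<close>; it is only applied to such functions.\<close>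

definition sup_norm :: "'x set \<Rightarrow> ('x \<Rightarrow> real) \<Rightarrow> real" where
  "sup_norm X f = (SUP x\<in>X. \<bar>f x\<bar>)"

lemma step_kernel_measurable:
  assumes "is_mdp M" "\<pi> \<in> policies M" "x \<in> state_set M"
  shows "step_kernel M \<pi> x t \<in> PiM {0..<t} (\<lambda>_. sa_space M) \<rightarrow>\<^sub>M prob_algebra (sa_space M)"
proof -
  let ?H = "PiM {0..<t} (\<lambda>_. sa_space M)"
  have P: "(\<lambda>(x, a). trans M a x) \<in> sa_space M \<rightarrow>\<^sub>M prob_algebra (states M)"
    and \<pi>: "\<pi> t \<in> ?H \<Otimes>\<^sub>M states M \<rightarrow>\<^sub>M prob_algebra (actions M)"
    using assms by (auto simp: is_mdp_def policies_def)
  have 1: "(\<lambda>h. if t = 0 then return (states M) x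
      else trans M (snd (h (t - 1))) (fst (h (t - 1)))) \<in> ?H \<rightarrow>\<^sub>M prob_algebra (states M)"
  proof (cases "t = 0")
    case True
    then show ?thesis
      using assms(3) by (auto simp: space_prob_algebra prob_space_return)
  next
    case False
    then have "(\<lambda>h. h (t - 1)) \<in> ?H \<rightarrow>\<^sub>M sa_space M"
      by (intro measurable_component_singleton) auto
    from measurable_compose[OF this P] False show ?thesis
      by (simp add: split_beta')
  qed
  have 2: "(\<lambda>(h, y). distr (\<pi> t (h, y)) (sa_space M) (Pair y))
      \<in> ?H \<Otimes>\<^sub>M states M \<rightarrow>\<^sub>M prob_algebra (sa_space M)"
    unfolding split_beta'
    by (intro measurable_distr_prob_space2[OF _, where M="actions M"]) (use \<pi> in auto)
  show ?thesis
    unfolding step_kernel_def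
    by (rule measurable_bind_prob_space2[OF 1]) (use 2 in \<open>simp add: split_beta'\<close>)
qed

lemma Ionescu_Tulcea_step_kernel:
  assumes "is_mdp M" "\<pi> \<in> policies M" "x \<in> state_set M"
  shows "Ionescu_Tulcea (step_kernel M \<pi> x) (\<lambda>_. sa_space M)"
proof (rule Ionescu_Tulcea.intro)
  show "step_kernel M \<pi> x i \<in> PiM {0..<i} (\<lambda>_. sa_space M) \<rightarrow>\<^sub>M subprob_algebra (sa_space M)" for i
    using step_kernel_measurable[OF assms] by (rule measurable_prob_algebraD)
  show "prob_space (step_kernel M \<pi> x i h)"
    if "h \<in> space (PiM {0..<i} (\<lambda>_. sa_space M))" for i h
    using measurable_space[OF step_kernel_measurable[OF assms] that]
    by (simp add: space_prob_algebra)
qed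

end

theory Submission
  imports Defs
begin

text \<open>One step \<open>up_step\<close> of the recursion is a \<open>\<gamma>\<close>-contraction, because maxima and expectations are
  nonexpansive for the sup-norm. Replacing \<open>\<Phi>\<close> by the corresponding difference for \<open>V\<^sup>\<star>\<close> makes the
  target at \<open>V\<^sup>\<star>\<close> deterministic, equal to the Bellman target, at the cost of \<open>2 \<gamma> \<parallel>V\<^sup>\<pi> - V\<^sup>\<star>\<parallel>\<close>; iterating
  this gives the error bounds. Since \<open>\<Phi>\<close> has mean zero, \<open>E max \<ge> max E\<close>, applied at a maximizing action of
  the Bellman equation, gives the lower bound by \<open>V\<^sup>\<star>\<close>, up to a geometrically vanishing error when the initial function is not above \<open>V\<^sup>\<star>\<close>. That
  \<open>\<Phi>\<close> is integrable with mean zero needs \<open>V\<^sup>\<pi>\<close> to be measurable, so the Ionescu-Tulcea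
  measure has to depend measurably on the initial state.\<close>

section \<open>Measurable dependence of the trajectory law on the initial state\<close>

text \<open>The product sigma-algebra is generated by an intersection-stable family of cylinders.
  Each cylinder constrains only finitely many coordinates, so its mass can be read off a
  finite-horizon law, and these laws arise by repeatedly binding jointly measurable kernels.\<close>

lemma measurable_Ionescu_Tulcea_lim:
  fixes P :: "'b \<Rightarrow> nat \<Rightarrow> (nat \<Rightarrow> 'a) \<Rightarrow> 'a measure"
  assumes P: "\<And>i. (\<lambda>(x, h). P x i h) \<in> L \<Otimes>\<^sub>M PiM {0..<i} N \<rightarrow>\<^sub>M prob_algebra (N i)"
  shows "(\<lambda>x. projective_family.lim UNIV (Ionescu_Tulcea.CI (P x) N) N)
           \<in> L \<rightarrow>\<^sub>M prob_algebra (PiM UNIV N)"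
proof -
  have IT: "Ionescu_Tulcea (P x) N" if "x \<in> space L" for x
  proof (rule Ionescu_Tulcea.intro)
    show "P x i \<in> PiM {0..<i} N \<rightarrow>\<^sub>M subprob_algebra (N i)" for i
      using measurable_compose[OF measurable_Pair1'[OF that] P]
      by (simp add: measurable_prob_algebraD)
    show "prob_space (P x i h)" if "h \<in> space (PiM {0..<i} N)" for i h
      using measurable_space[OF P, of "(x, h)" i] that \<open>x \<in> space L\<close>
      by (auto simp: space_pair_measure space_prob_algebra)
  qed
  \<comment> \<open>\<open>C x n\<close> at the history \<open>\<lambda>_. undefined\<close> is the
    law of the first \<open>n\<close> coordinates: that history is the only point of the empty
    product \<open>PiM {0..<0} N\<close>, from which the construction starts.\<close>
  define C where "C x = Ionescu_Tulcea.C (P x) N 0" for x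
  have C: "(\<lambda>x. C x n (\<lambda>_. undefined)) \<in> L \<rightarrow>\<^sub>M prob_algebra (PiM {0..<n} N)" for n
  proof (induction n)
    case 0
    have "return (PiM {0..<0} N) (\<lambda>_. undefined) \<in> space (prob_algebra (PiM {0..<0} N))"
      by (simp add: space_prob_algebra prob_space_return space_PiM)
    then have "(\<lambda>x. return (PiM {0..<0} N) (\<lambda>_. undefined)) \<in> L \<rightarrow>\<^sub>M prob_algebra (PiM {0..<0} N)"
      by simp
    then show ?case
      by (rule measurable_cong[THEN iffD1, rotated]) (simp add: C_def Ionescu_Tulcea.C.simps[OF IT])
  next
    case (Suc n)
    \<comment> \<open>Appending the drawn coordinate to the history turns \<open>P x n\<close> into
      a kernel between history spaces; binding with it is the recursion step of
      \<open>C\<close>.\<close>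
    have "(\<lambda>(x, h). distr (P x n h) (PiM {0..<Suc n} N) (fun_upd h n))
        \<in> L \<Otimes>\<^sub>M PiM {0..<n} N \<rightarrow>\<^sub>M prob_algebra (PiM {0..<Suc n} N)"
      using P[of n] unfolding split_beta'
      by (intro measurable_distr_prob_space2[where M = "N n"])
        (auto simp: split_beta' intro!: measurable_fun_upd[where J="{0..<n}"])
    from measurable_bind_prob_space2[OF Suc this]
    show ?case
    proof (rule measurable_cong[THEN iffD1, rotated])
      fix x assume "x \<in> space L"
      note IT = IT[OF this]
      have "Ionescu_Tulcea.eP (P x) N n = (\<lambda>h. distr (P x n h) (PiM {0..<Suc n} N) (fun_upd h n))"
        by (rule ext) (rule Ionescu_Tulcea.eP_def[OF IT])
      then show "C x n (\<lambda>_. undefined) \<bind> (\<lambda>h. distr (P x n h) (PiM {0..<Suc n} N) (fun_upd h n))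
          = C x (Suc n) (\<lambda>_. undefined)"
        by (simp only: C_def Ionescu_Tulcea.C.simps[OF IT] add_0)
    qed
  qed
  show ?thesis
  proof (rule measurable_prob_algebra_generated[OF sets_PiM Int_stable_prod_algebra prod_algebra_sets_into_space])
    fix x assume x: "x \<in> space L"
    interpret Ionescu_Tulcea "P x" N by (rule IT[OF x])
    show "sets PF.lim = sets (PiM UNIV N)" by simp
    interpret CI: prob_space "CI {}" by (rule PF.prob_space_P) auto
    \<comment> \<open>The whole space is the cylinder over the empty index set, so its mass is that
      of the probability measure \<open>CI {}\<close>.\<close>
    have "PF.emb UNIV {} (space (PiM {} N)) = space (PiM UNIV N)"
      by (auto simp: prod_emb_def space_PiM)
    with lim[of "{}" "space (PiM {} N)"] show "prob_space PF.lim"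
      using CI.emeasure_space_1 by (intro prob_spaceI) (simp add: PF.space_P)
  next
    fix A assume "A \<in> prod_algebra UNIV N"
    from prod_algebraE[OF this] obtain J E where A: "A = prod_emb UNIV N J (PiE J E)"
      and J: "finite J" "\<And>i. i \<in> J \<Longrightarrow> E i \<in> sets (N i)"
      by metis
    then have E: "PiE J E \<in> sets (PiM J N)" by auto
    \<comment> \<open>Any horizon beyond the finite set \<open>J\<close> works: the limit gives the
      cylinder the mass that \<open>C x n\<close> gives to its trace on the first \<open>n\<close>
      coordinates.\<close>
    obtain n where n: "J \<subseteq> {0..<n}"
      using finite_nat_bounded[OF J(1)] by (auto simp: lessThan_atLeast0)
    let ?A = "prod_emb {0..<n} N J (PiE J E)"
    have "?A \<in> sets (PiM {0..<n} N)"
      using E n by simp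
    from measurable_compose[OF measurable_prob_algebraD[OF C] measurable_emeasure_subprob_algebra[OF this]]
    show "(\<lambda>x. emeasure (projective_family.lim UNIV (Ionescu_Tulcea.CI (P x) N) N) A) \<in> borel_measurable L"
      by (rule measurable_cong[THEN iffD1, rotated])
        (simp add: A C_def Ionescu_Tulcea.lim[OF IT J(1) E] Ionescu_Tulcea.emeasure_CI[OF IT n E])
  qed
qed

text \<open>Here the initial state becomes a variable, as the preceding lemma requires. It enters
  only at time 0, through \<open>return\<close>, which is itself a measurable kernel; at later times
  the last pair of the history determines the transition.\<close>

lemma step_kernel_jointly_measurable:
  assumes "is_mdp M" "\<pi> \<in> policies M"
  shows "(\<lambda>(x, h). step_kernel M \<pi> x t h)
           \<in> states M \<Otimes>\<^sub>M PiM {0..<t} (\<lambda>_. sa_space M) \<rightarrow>\<^sub>M prob_algebra (sa_space M)"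
proof -
  let ?H = "PiM {0..<t} (\<lambda>_. sa_space M)"
  have P: "(\<lambda>(x, a). trans M a x) \<in> sa_space M \<rightarrow>\<^sub>M prob_algebra (states M)"
    and \<pi>[measurable]: "\<pi> t \<in> ?H \<Otimes>\<^sub>M states M \<rightarrow>\<^sub>M prob_algebra (actions M)"
    using assms by (auto simp: is_mdp_def policies_def)
  have 1: "(\<lambda>z. if t = 0 then return (states M) (fst z)
      else trans M (snd (snd z (t - 1))) (fst (snd z (t - 1))))
      \<in> states M \<Otimes>\<^sub>M ?H \<rightarrow>\<^sub>M prob_algebra (states M)"
  proof (cases "t = 0")
    case False
    then have "(\<lambda>z. snd z (t - 1)) \<in> states M \<Otimes>\<^sub>M ?H \<rightarrow>\<^sub>M sa_space M"
      by (intro measurable_compose[OF measurable_snd] measurable_component_singleton) auto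
    from measurable_compose[OF this P] False show ?thesis
      by (simp add: split_beta')
  qed (simp add: measurable_compose[OF measurable_fst measurable_return_prob_space])
  have 2: "(\<lambda>(z, y). distr (\<pi> t (snd z, y)) (sa_space M) (Pair y))
      \<in> (states M \<Otimes>\<^sub>M ?H) \<Otimes>\<^sub>M states M \<rightarrow>\<^sub>M prob_algebra (sa_space M)"
    unfolding split_beta'
    by (intro measurable_distr_prob_space2[where M="actions M"]) auto
  show ?thesis
    using measurable_bind_prob_space2[OF 1 2] by (simp add: step_kernel_def split_beta')
qed

lemma trajectory_law_measurable:
  assumes "is_mdp M" "\<pi> \<in> policies M"
  shows "trajectory_law M \<pi> \<in> states M \<rightarrow>\<^sub>M prob_algebra (PiM UNIV (\<lambda>_. sa_space M))"
  unfolding trajectory_law_def[abs_def]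
  by (intro measurable_Ionescu_Tulcea_lim step_kernel_jointly_measurable assms)

section \<open>Measurability and boundedness of policy values\<close>

lemma discounted_reward_measurable:
  assumes "is_mdp M"
  shows "(\<lambda>\<omega>. \<Sum>t. \<gamma> ^ t * rew M (snd (\<omega> t)) (fst (\<omega> t)))
           \<in> borel_measurable (PiM UNIV (\<lambda>_. sa_space M))"
proof -
  have "(\<lambda>(x, a). rew M a x) \<in> borel_measurable (sa_space M)"
    using assms by (simp add: is_mdp_def)
  then have [measurable]: "(\<lambda>\<omega>. rew M (snd (\<omega> t)) (fst (\<omega> t)))
      \<in> borel_measurable (PiM UNIV (\<lambda>_. sa_space M))" for t
    using measurable_compose[OF measurable_component_singleton[OF UNIV_I, of t "\<lambda>_. sa_space M"]]
    by (simp add: split_beta')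
  show ?thesis by measurable
qed

lemma policy_value_measurable:
  assumes "is_mdp M" "\<pi> \<in> policies M"
  shows "policy_value M \<gamma> \<pi> \<in> borel_measurable (states M)"
  unfolding policy_value_def[abs_def]
  by (intro measurable_compose[OF measurable_prob_algebraD[OF trajectory_law_measurable[OF assms]]]
      integral_measurable_subprob_algebra discounted_reward_measurable assms)

lemma (in prob_space) abs_integral_le_const:
  fixes f :: "'a \<Rightarrow> real"
  assumes "f \<in> borel_measurable M" "\<And>x. x \<in> space M \<Longrightarrow> \<bar>f x\<bar> \<le> c"
  shows "\<bar>integral\<^sup>L M f\<bar> \<le> c"
proof -
  have "integrable M f"
    using assms by (intro integrable_const_bound[of _ c]) auto
  then have "(\<integral>x. \<bar>f x\<bar> \<partial>M) \<le> c"
    using assms by (intro integral_le_const) auto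
  then show ?thesis
    using integral_abs_bound[of M f] by linarith
qed

text \<open>On every trajectory the discounted series is dominated by a geometric series, and
  averaging under a probability law keeps the bound. The bound is the same for all policies, which
  later makes the supremum over policies finite.\<close>

lemma abs_policy_value_le:
  assumes "is_mdp M" "\<pi> \<in> policies M" "0 \<le> \<gamma>" "\<gamma> < 1" "x \<in> state_set M"
    and R: "\<And>a x. a \<in> action_set M \<Longrightarrow> x \<in> state_set M \<Longrightarrow> \<bar>rew M a x\<bar> \<le> R"
  shows "\<bar>policy_value M \<gamma> \<pi> x\<bar> \<le> R / (1 - \<gamma>)"
proof -
  let ?T = "trajectory_law M \<pi> x"
  have T: "sets ?T = sets (PiM UNIV (\<lambda>_. sa_space M))" "prob_space ?T"
    using measurable_space[OF trajectory_law_measurable[OF assms(1,2)] assms(5)]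
    by (auto simp: space_prob_algebra)
  interpret prob_space ?T by fact
  show ?thesis
    unfolding policy_value_def
  proof (rule abs_integral_le_const)
    show "(\<lambda>\<omega>. \<Sum>t. \<gamma> ^ t * rew M (snd (\<omega> t)) (fst (\<omega> t))) \<in> borel_measurable ?T"
      using discounted_reward_measurable[OF assms(1)] by (simp add: measurable_cong_sets[OF T(1) refl])
    fix \<omega> assume "\<omega> \<in> space ?T"
    then have "\<omega> t \<in> space (sa_space M)" for t
      by (auto simp: sets_eq_imp_space_eq[OF T(1)] space_PiM PiE_iff)
    then have "\<bar>rew M (snd (\<omega> t)) (fst (\<omega> t))\<bar> \<le> R" for t
      using R by (force simp: space_pair_measure mem_Times_iff)
    then have le: "norm (\<gamma> ^ t * rew M (snd (\<omega> t)) (fst (\<omega> t))) \<le> \<gamma> ^ t * R" for t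
      using assms(3) by (auto simp: abs_mult intro!: mult_left_mono)
    have sums: "(\<lambda>t. \<gamma> ^ t * R) sums (R / (1 - \<gamma>))"
      using sums_mult2[OF geometric_sums[of \<gamma>], of R] assms(3,4) by simp
    then show "\<bar>\<Sum>t. \<gamma> ^ t * rew M (snd (\<omega> t)) (fst (\<omega> t))\<bar> \<le> R / (1 - \<gamma>)"
      using norm_suminf_le[of "\<lambda>t. \<gamma> ^ t * rew M (snd (\<omega> t)) (fst (\<omega> t))", OF le]
      by (simp add: sums_iff)
  qed
qed


section \<open>Suprema and the sup-norm\<close>

lemma abs_SUP_diff_le:
  fixes f g :: "'a \<Rightarrow> real"
  assumes "A \<noteq> {}" "bdd_above (f ` A)" "bdd_above (g ` A)" "\<And>a. a \<in> A \<Longrightarrow> \<bar>f a - g a\<bar> \<le> c"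
  shows "\<bar>(SUP a\<in>A. f a) - (SUP a\<in>A. g a)\<bar> \<le> c"
proof -
  have "f a \<le> (SUP a\<in>A. g a) + c" if "a \<in> A" for a
    using cSUP_upper[OF that assms(3)] assms(4)[OF that] by linarith
  moreover have "g a \<le> (SUP a\<in>A. f a) + c" if "a \<in> A" for a
    using cSUP_upper[OF that assms(2)] assms(4)[OF that] by linarith
  ultimately have "(SUP a\<in>A. f a) \<le> (SUP a\<in>A. g a) + c" "(SUP a\<in>A. g a) \<le> (SUP a\<in>A. f a) + c"
    by (auto intro!: cSUP_least assms(1))
  then show ?thesis by linarith
qed

text \<open>The bound \<open>c\<close> certifies that the real supremum is taken over a set bounded
  above; its size is irrelevant.\<close>

lemma abs_le_sup_norm:
  assumes "x \<in> X" "\<And>y. y \<in> X \<Longrightarrow> \<bar>f y\<bar> \<le> c"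
  shows "\<bar>f x\<bar> \<le> sup_norm X f"
  unfolding sup_norm_def using assms by (intro cSUP_upper bdd_aboveI2) auto

lemma sup_norm_le:
  assumes "X \<noteq> {}" "\<And>x. x \<in> X \<Longrightarrow> \<bar>f x\<bar> \<le> c"
  shows "sup_norm X f \<le> c"
  unfolding sup_norm_def using assms by (intro cSUP_least) auto

section \<open>Standing assumptions and bounded measurable functions\<close>

locale upper_bound_recursion =
  fixes M :: "('x, 'a) mdp" and \<gamma> :: real and \<pi> :: "('x, 'a) policy"
    and \<Omega> :: "'x \<Rightarrow> 'w measure" and Y :: "'x \<Rightarrow> 'a \<Rightarrow> 'w \<Rightarrow> 'x"
  assumes mdp: "is_mdp M"
    and rewards: "bounded_rewards M"
    and \<gamma>: "0 < \<gamma>" "\<gamma> < 1"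
    and policy: "\<pi> \<in> policies M"
    and bellman: "bellman_optimality M \<gamma> (opt_value M \<gamma>)"
    and next_states: "next_state_variables M \<Omega> Y"
begin

abbreviation "X \<equiv> state_set M"
abbreviation "A \<equiv> action_set M"
abbreviation "V\<pi> \<equiv> policy_value M \<gamma> \<pi>"
abbreviation "Vopt \<equiv> opt_value M \<gamma>"

definition bounded_measurable :: "('x \<Rightarrow> real) \<Rightarrow> bool" where
  "bounded_measurable V \<longleftrightarrow> V \<in> borel_measurable (states M) \<and> bounded (V ` X)"

lemma bounded_measurableE:
  assumes "bounded_measurable V"
  obtains c where "0 \<le> c" "\<And>x. x \<in> X \<Longrightarrow> \<bar>V x\<bar> \<le> c"
proof -
  obtain c where "0 < c" "\<forall>v\<in>V ` X. norm v \<le> c"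
    using assms bounded_pos unfolding bounded_measurable_def by blast
  then show ?thesis
    by (intro that[of c]) auto
qed

lemma bounded_measurable_diff:
  assumes "bounded_measurable V" "bounded_measurable W"
  shows "bounded_measurable (\<lambda>x. V x - W x)"
  using assms bounded_minus_comp[of V X W] by (auto simp: bounded_measurable_def)

lemma nonempty: "X \<noteq> {}" "A \<noteq> {}"
  using mdp by (auto simp: is_mdp_def)

lemma reward_bound:
  obtains R where "\<And>a x. a \<in> A \<Longrightarrow> x \<in> X \<Longrightarrow> \<bar>rew M a x\<bar> \<le> R"
  using rewards unfolding bounded_rewards_def by blast

lemma prob_space_\<Omega>: "x \<in> X \<Longrightarrow> prob_space (\<Omega> x)"
  and Y_measurable: "x \<in> X \<Longrightarrow> a \<in> A \<Longrightarrow> Y x a \<in> \<Omega> x \<rightarrow>\<^sub>M states M"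
  and distr_Y: "x \<in> X \<Longrightarrow> a \<in> A \<Longrightarrow> distr (\<Omega> x) (states M) (Y x a) = trans M a x"
  using next_states by (auto simp: next_state_variables_def)

lemma Y_in_X: "x \<in> X \<Longrightarrow> a \<in> A \<Longrightarrow> w \<in> space (\<Omega> x) \<Longrightarrow> Y x a w \<in> X"
  using Y_measurable by (rule measurable_space)

lemma policy_value_bounds:
  obtains c where "\<And>\<sigma> x. \<sigma> \<in> policies M \<Longrightarrow> x \<in> X \<Longrightarrow> \<bar>policy_value M \<gamma> \<sigma> x\<bar> \<le> c"
proof -
  obtain R where "\<And>a x. a \<in> A \<Longrightarrow> x \<in> X \<Longrightarrow> \<bar>rew M a x\<bar> \<le> R"
    using reward_bound by blast
  then show ?thesis
    using \<gamma> by (intro that[of "R / (1 - \<gamma>)"] abs_policy_value_le mdp) auto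
qed

lemma bounded_measurable_V\<pi>: "bounded_measurable V\<pi>"
proof -
  obtain c where "\<And>\<sigma> x. \<sigma> \<in> policies M \<Longrightarrow> x \<in> X \<Longrightarrow> \<bar>policy_value M \<gamma> \<sigma> x\<bar> \<le> c"
    using policy_value_bounds by blast
  with policy have "bounded (V\<pi> ` X)"
    by (auto simp: bounded_iff)
  then show ?thesis
    using policy_value_measurable[OF mdp policy] by (simp add: bounded_measurable_def)
qed

lemma V\<pi>_le_Vopt:
  assumes "x \<in> X"
  shows "V\<pi> x \<le> Vopt x"
proof -
  obtain c where "\<And>\<sigma> x. \<sigma> \<in> policies M \<Longrightarrow> x \<in> X \<Longrightarrow> \<bar>policy_value M \<gamma> \<sigma> x\<bar> \<le> c"
    using policy_value_bounds by blast
  then have "bdd_above ((\<lambda>\<sigma>. policy_value M \<gamma> \<sigma> x) ` policies M)"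
    using assms by (intro bdd_aboveI2[of _ _ c]) (force simp: abs_le_iff)
  then show ?thesis
    unfolding opt_value_def by (rule cSUP_upper[OF policy])
qed

text \<open>The upper bound is uniform over policies and the lower bound comes from the single
  policy \<open>\<pi>\<close>. Measurability is taken from the Bellman hypothesis, since a supremum
  over uncountably many policies need not be measurable.\<close>

lemma bounded_measurable_Vopt: "bounded_measurable Vopt"
proof -
  obtain c where c: "\<And>\<sigma> x. \<sigma> \<in> policies M \<Longrightarrow> x \<in> X \<Longrightarrow> \<bar>policy_value M \<gamma> \<sigma> x\<bar> \<le> c"
    using policy_value_bounds by blast
  have "\<bar>Vopt x\<bar> \<le> c" if "x \<in> X" for x
  proof -
    have "Vopt x \<le> c"
      unfolding opt_value_def using c that policy by (intro cSUP_least) (auto simp: abs_le_iff)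
    moreover have "- c \<le> Vopt x"
      using c[OF policy that] V\<pi>_le_Vopt[OF that] by linarith
    ultimately show ?thesis by linarith
  qed
  then show ?thesis
    using bellman by (auto simp: bounded_measurable_def bellman_optimality_def bounded_iff)
qed

text \<open>Each claim concerns one action at a time, so the marginal law of \<open>Y x a\<close>
  decides it by change of variables, whatever the joint law over actions.\<close>

lemma
  assumes V: "bounded_measurable V" and x: "x \<in> X" and a: "a \<in> A"
  shows integrable_Y: "integrable (\<Omega> x) (\<lambda>w. V (Y x a w))"
    and integrable_trans: "integrable (trans M a x) V"
    and integral_Y: "(\<integral>w. V (Y x a w) \<partial>\<Omega> x) = trans_op M a V x"
proof -
  interpret prob_space "\<Omega> x" by (rule prob_space_\<Omega>[OF x])
  note [measurable] = Y_measurable[OF x a]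
  have [measurable]: "V \<in> borel_measurable (states M)"
    using V by (simp add: bounded_measurable_def)
  obtain c where "\<And>x. x \<in> X \<Longrightarrow> \<bar>V x\<bar> \<le> c"
    using bounded_measurableE[OF V] by blast
  then show "integrable (\<Omega> x) (\<lambda>w. V (Y x a w))"
    using Y_in_X[OF x a] by (intro integrable_const_bound[of _ c]) auto
  then show "integrable (trans M a x) V"
    unfolding distr_Y[OF x a, symmetric] by (subst integrable_distr_eq) auto
  show "(\<integral>w. V (Y x a w) \<partial>\<Omega> x) = trans_op M a V x"
    unfolding trans_op_def distr_Y[OF x a, symmetric] by (subst integral_distr) auto
qed

lemma trans_op_diff:
  assumes "bounded_measurable V" "bounded_measurable W" "x \<in> X" "a \<in> A"
  shows "trans_op M a (\<lambda>y. V y - W y) x = trans_op M a V x - trans_op M a W x"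
  unfolding trans_op_def using assms by (intro Bochner_Integration.integral_diff integrable_trans)

lemma abs_trans_op_le:
  assumes V: "bounded_measurable V" and xa: "x \<in> X" "a \<in> A" and c: "\<And>y. y \<in> X \<Longrightarrow> \<bar>V y\<bar> \<le> c"
  shows "\<bar>trans_op M a V x\<bar> \<le> c"
proof -
  have "\<bar>\<integral>w. V (Y x a w) \<partial>\<Omega> x\<bar> \<le> c"
    using integrable_Y[OF V xa] Y_in_X[OF xa] c
    by (intro prob_space.abs_integral_le_const prob_space_\<Omega> xa) auto
  then show ?thesis by (simp add: integral_Y[OF V xa])
qed

section \<open>One step of the recursion\<close>

abbreviation up_max :: "('x \<Rightarrow> real) \<Rightarrow> 'x \<Rightarrow> 'w \<Rightarrow> real" where
  "up_max V x w \<equiv> SUP a\<in>A. up_target M \<gamma> \<pi> Y V x w a"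

definition up_step :: "('x \<Rightarrow> real) \<Rightarrow> 'x \<Rightarrow> real" where
  "up_step V x = (\<integral>w. up_max V x w \<partial>\<Omega> x)"

text \<open>Collects what makes the inner supremum integrable; its measurability in \<open>w\<close>
  is imposed separately because the action set may be uncountable.\<close>

definition regular :: "('x \<Rightarrow> real) \<Rightarrow> bool" where
  "regular V \<longleftrightarrow> bounded_measurable V \<and> (\<forall>x\<in>X. up_max V x \<in> borel_measurable (\<Omega> x))"

lemma up_target_bounded:
  assumes V: "bounded_measurable V"
  obtains c where "\<And>x w a. x \<in> X \<Longrightarrow> w \<in> space (\<Omega> x) \<Longrightarrow> a \<in> A \<Longrightarrow> \<bar>up_target M \<gamma> \<pi> Y V x w a\<bar> \<le> c"
proof -
  obtain R where R: "\<And>a x. a \<in> A \<Longrightarrow> x \<in> X \<Longrightarrow> \<bar>rew M a x\<bar> \<le> R"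
    using reward_bound by blast
  obtain c where c: "\<And>x. x \<in> X \<Longrightarrow> \<bar>V x\<bar> \<le> c"
    using bounded_measurableE[OF V] by blast
  obtain d where d: "\<And>x. x \<in> X \<Longrightarrow> \<bar>V\<pi> x\<bar> \<le> d"
    using bounded_measurableE[OF bounded_measurable_V\<pi>] by blast
  \<comment> \<open>The two summands \<open>d\<close> bound the two terms of \<open>Phi\<close>:
    \<open>V\<pi>\<close> at the next state and its mean.\<close>
  have "\<bar>up_target M \<gamma> \<pi> Y V x w a\<bar> \<le> R + \<gamma> * (c + (d + d))"
    if "x \<in> X" "w \<in> space (\<Omega> x)" "a \<in> A" for x w a
  proof -
    have "Y x a w \<in> X"
      using that by (simp add: Y_in_X)
    then have "\<bar>V (Y x a w) - Phi M \<gamma> \<pi> x a (Y x a w)\<bar> \<le> c + (d + d)"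
      using c[of "Y x a w"] d[of "Y x a w"] abs_trans_op_le[OF bounded_measurable_V\<pi> \<open>x \<in> X\<close> \<open>a \<in> A\<close> d]
      unfolding Phi_def by linarith
    then have "\<bar>\<gamma> * (V (Y x a w) - Phi M \<gamma> \<pi> x a (Y x a w))\<bar> \<le> \<gamma> * (c + (d + d))"
      using \<gamma> by (simp add: abs_mult)
    with R[of a x] that show ?thesis
      unfolding up_target_def by linarith
  qed
  then show ?thesis by (rule that)
qed

lemma bdd_above_up_target:
  assumes V: "bounded_measurable V" and x: "x \<in> X" and w: "w \<in> space (\<Omega> x)"
  shows "bdd_above (up_target M \<gamma> \<pi> Y V x w ` A)"
proof -
  obtain c where "\<And>x w a. x \<in> X \<Longrightarrow> w \<in> space (\<Omega> x) \<Longrightarrow> a \<in> A \<Longrightarrow> \<bar>up_target M \<gamma> \<pi> Y V x w a\<bar> \<le> c"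
    using up_target_bounded[OF V] by blast
  with x w show ?thesis
    by (intro bdd_aboveI2[of _ _ c]) (force simp: abs_le_iff)
qed

lemma up_max_bounded:
  assumes V: "bounded_measurable V"
  obtains c where "\<And>x w. x \<in> X \<Longrightarrow> w \<in> space (\<Omega> x) \<Longrightarrow> \<bar>up_max V x w\<bar> \<le> c"
proof -
  obtain c where "\<And>x w a. x \<in> X \<Longrightarrow> w \<in> space (\<Omega> x) \<Longrightarrow> a \<in> A \<Longrightarrow> \<bar>up_target M \<gamma> \<pi> Y V x w a\<bar> \<le> c"
    using up_target_bounded[OF V] by blast
  \<comment> \<open>Comparison with the zero function, whose supremum over the nonempty action set
    is 0, reduces boundedness to nonexpansiveness of suprema.\<close>
  then have "\<bar>up_max V x w - (SUP a\<in>A. 0)\<bar> \<le> c" if "x \<in> X" "w \<in> space (\<Omega> x)" for x w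
    using that nonempty bdd_above_up_target[OF V that] by (intro abs_SUP_diff_le) auto
  then show ?thesis
    using nonempty by (intro that[of c]) auto
qed

lemma integrable_up_max:
  assumes V: "regular V" and x: "x \<in> X"
  shows "integrable (\<Omega> x) (up_max V x)"
proof -
  interpret prob_space "\<Omega> x" by (rule prob_space_\<Omega>[OF x])
  obtain c where "\<And>x w. x \<in> X \<Longrightarrow> w \<in> space (\<Omega> x) \<Longrightarrow> \<bar>up_max V x w\<bar> \<le> c"
    using V up_max_bounded unfolding regular_def by blast
  then show ?thesis
    using V x by (intro integrable_const_bound[of _ c]) (auto simp: regular_def)
qed

lemma bounded_up_step:
  assumes V: "regular V"
  shows "bounded (up_step V ` X)"
proof -
  obtain c where c: "\<And>x w. x \<in> X \<Longrightarrow> w \<in> space (\<Omega> x) \<Longrightarrow> \<bar>up_max V x w\<bar> \<le> c"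
    using V up_max_bounded unfolding regular_def by blast
  have "\<bar>up_step V x\<bar> \<le> c" if "x \<in> X" for x
    unfolding up_step_def using V c that
    by (intro prob_space.abs_integral_le_const prob_space_\<Omega>) (auto simp: regular_def)
  then show ?thesis by (auto simp: bounded_iff)
qed

text \<open>Rewards and \<open>Phi\<close> cancel in the difference of the two targets, leaving
  \<gamma> times \<open>V - W\<close> at the same next state; supremum and expectation both preserve
  a uniform bound.\<close>

lemma up_step_contraction:
  assumes V: "regular V" and W: "regular W" and x: "x \<in> X"
    and c: "\<And>y. y \<in> X \<Longrightarrow> \<bar>V y - W y\<bar> \<le> c"
  shows "\<bar>up_step V x - up_step W x\<bar> \<le> \<gamma> * c"
proof -
  have "\<bar>\<integral>w. up_max V x w - up_max W x w \<partial>\<Omega> x\<bar> \<le> \<gamma> * c"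
  proof (intro prob_space.abs_integral_le_const prob_space_\<Omega> x)
    fix w assume w: "w \<in> space (\<Omega> x)"
    have "\<bar>up_target M \<gamma> \<pi> Y V x w a - up_target M \<gamma> \<pi> Y W x w a\<bar> \<le> \<gamma> * c" if "a \<in> A" for a
    proof -
      have "up_target M \<gamma> \<pi> Y V x w a - up_target M \<gamma> \<pi> Y W x w a = \<gamma> * (V (Y x a w) - W (Y x a w))"
        by (simp add: up_target_def algebra_simps)
      then show ?thesis
        using \<gamma> c[OF Y_in_X[OF x that w]] by (simp add: abs_mult)
    qed
    then show "\<bar>up_max V x w - up_max W x w\<bar> \<le> \<gamma> * c"
      using V W x w nonempty
      by (intro abs_SUP_diff_le bdd_above_up_target) (auto simp: regular_def)
  qed (use V W x in \<open>auto simp: regular_def intro!: borel_measurable_diff\<close>)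
  then show ?thesis
    using V W x by (simp add: up_step_def integrable_up_max)
qed

lemma Vopt_eq: "x \<in> X \<Longrightarrow> Vopt x = (SUP a\<in>A. rew M a x + \<gamma> * trans_op M a Vopt x)"
  using bellman by (simp add: bellman_optimality_def)

text \<open>For each outcome \<open>w\<close> and action, the target minus the Bellman target is
  \<gamma> times three terms: the error of \<open>V\<close> at the next state, bounded by
  \<open>c\<close>, and the error of \<open>V\<pi>\<close> at the next state and its mean, each
  bounded by \<open>d\<close>. Hence the factor 2.\<close>

lemma up_step_error:
  assumes V: "regular V" and x: "x \<in> X"
    and c: "\<And>y. y \<in> X \<Longrightarrow> \<bar>V y - Vopt y\<bar> \<le> c"
    and d: "\<And>y. y \<in> X \<Longrightarrow> \<bar>V\<pi> y - Vopt y\<bar> \<le> d"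
  shows "\<bar>up_step V x - Vopt x\<bar> \<le> \<gamma> * c + 2 * \<gamma> * d"
proof -
  interpret prob_space "\<Omega> x" by (rule prob_space_\<Omega>[OF x])
  have BV: "bounded_measurable V" and meas: "up_max V x \<in> borel_measurable (\<Omega> x)"
    using V x by (auto simp: regular_def)
  have bdd: "bdd_above ((\<lambda>a. rew M a x + \<gamma> * trans_op M a Vopt x) ` A)"
    using bellman x unfolding bellman_optimality_def has_max_def by (force intro: bdd_aboveI2)
  have "\<bar>\<integral>w. up_max V x w - Vopt x \<partial>\<Omega> x\<bar> \<le> \<gamma> * c + 2 * \<gamma> * d"
  proof (rule abs_integral_le_const)
    fix w assume w: "w \<in> space (\<Omega> x)"
    have "\<bar>up_target M \<gamma> \<pi> Y V x w a - (rew M a x + \<gamma> * trans_op M a Vopt x)\<bar> \<le> \<gamma> * c + 2 * \<gamma> * d"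
      if a: "a \<in> A" for a
    proof -
      let ?y = "Y x a w" and ?D = "trans_op M a V\<pi> x - trans_op M a Vopt x"
      have y: "?y \<in> X"
        by (rule Y_in_X[OF x a w])
      have "\<bar>?D\<bar> \<le> d"
        using abs_trans_op_le[OF bounded_measurable_diff x a d]
        by (simp add: trans_op_diff bounded_measurable_V\<pi> bounded_measurable_Vopt x a)
      then have "\<bar>(V ?y - Vopt ?y) - (V\<pi> ?y - Vopt ?y) + ?D\<bar> \<le> c + 2 * d"
        using c[OF y] d[OF y] by linarith
      then have "\<bar>\<gamma> * ((V ?y - Vopt ?y) - (V\<pi> ?y - Vopt ?y) + ?D)\<bar> \<le> \<gamma> * (c + 2 * d)"
        using \<gamma> by (simp add: abs_mult)
      moreover have "up_target M \<gamma> \<pi> Y V x w a - (rew M a x + \<gamma> * trans_op M a Vopt x)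
          = \<gamma> * ((V ?y - Vopt ?y) - (V\<pi> ?y - Vopt ?y) + ?D)"
        by (simp add: up_target_def Phi_def algebra_simps)
      ultimately show ?thesis
        by (simp add: algebra_simps)
    qed
    then show "\<bar>up_max V x w - Vopt x\<bar> \<le> \<gamma> * c + 2 * \<gamma> * d"
      unfolding Vopt_eq[OF x]
      by (intro abs_SUP_diff_le bdd_above_up_target BV x w bdd nonempty)
  qed (use meas in simp)
  then show ?thesis
    using integrable_up_max[OF V x] by (simp add: up_step_def prob_space)
qed

text \<open>A supremum dominates the target at one fixed action; that action is chosen as a
  maximizer in the Bellman equation, before \<open>w\<close> is seen. The slack \<open>c\<close> is
  damped by \<gamma>, so the estimate also serves functions not above \<open>Vopt\<close>.\<close>

lemma up_step_ge:
  assumes V: "regular V" and x: "x \<in> X"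
    and c: "\<And>y. y \<in> X \<Longrightarrow> Vopt y - c \<le> V y"
  shows "Vopt x - \<gamma> * c \<le> up_step V x"
proof -
  interpret prob_space "\<Omega> x" by (rule prob_space_\<Omega>[OF x])
  have BV: "bounded_measurable V"
    using V by (simp add: regular_def)
  obtain a where a: "a \<in> A" and
    max: "\<And>b. b \<in> A \<Longrightarrow> rew M b x + \<gamma> * trans_op M b Vopt x \<le> rew M a x + \<gamma> * trans_op M a Vopt x"
    using bellman x unfolding bellman_optimality_def has_max_def by blast
  have int: "integrable (\<Omega> x) (\<lambda>w. V (Y x a w))" "integrable (\<Omega> x) (\<lambda>w. V\<pi> (Y x a w))"
    using BV bounded_measurable_V\<pi> x a by (auto intro: integrable_Y)
  have "Vopt x \<le> rew M a x + \<gamma> * trans_op M a Vopt x"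
    unfolding Vopt_eq[OF x] using max nonempty by (intro cSUP_least)
  also have "\<dots> \<le> rew M a x + \<gamma> * (trans_op M a V x + c)"
  proof -
    have "trans_op M a (\<lambda>y. Vopt y - V y) x = (\<integral>w. Vopt (Y x a w) - V (Y x a w) \<partial>\<Omega> x)"
      using bounded_measurable_diff[OF bounded_measurable_Vopt BV] x a by (rule integral_Y[symmetric])
    also have "\<dots> \<le> c"
      using integrable_Y[OF bounded_measurable_Vopt x a] int(1) c Y_in_X[OF x a]
      by (intro integral_le_const) (auto simp: algebra_simps)
    finally show ?thesis
      using \<gamma> by (simp add: trans_op_diff bounded_measurable_Vopt BV x a)
  qed
  \<comment> \<open>For a fixed action \<open>Phi\<close> has mean zero under the law of
    \<open>Y x a\<close>, so it can be inserted for free.\<close>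
  also have "\<dots> = (\<integral>w. up_target M \<gamma> \<pi> Y V x w a \<partial>\<Omega> x) + \<gamma> * c"
    using int by (simp add: up_target_def Phi_def integral_Y BV bounded_measurable_V\<pi> x a prob_space
        algebra_simps)
  also have "(\<integral>w. up_target M \<gamma> \<pi> Y V x w a \<partial>\<Omega> x) \<le> up_step V x"
    unfolding up_step_def
  proof (rule integral_mono)
    show "integrable (\<Omega> x) (\<lambda>w. up_target M \<gamma> \<pi> Y V x w a)"
      using int by (simp add: up_target_def Phi_def)
  qed (use integrable_up_max[OF V x] bdd_above_up_target[OF BV x] a in \<open>auto intro: cSUP_upper\<close>)
  finally show ?thesis by simp
qed

section \<open>Iterates, their error bounds and their limit\<close>

abbreviation "Vup \<equiv> V_up M \<gamma> \<pi> \<Omega> Y"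
abbreviation "admissible \<equiv> admissible_init M \<gamma> \<pi> \<Omega> Y"

lemma Vup_Suc: "Vup V0 (Suc k) = up_step (Vup V0 k)"
  by (simp add: up_step_def[abs_def])

text \<open>Admissibility supplies all the measurability; boundedness beyond the initial function is
  the inductive content.\<close>

lemma regular_Vup:
  assumes "admissible V0"
  shows "regular (Vup V0 k)"
proof (induction k)
  case 0
  show ?case
    using assms[unfolded admissible_init_def]
    by (auto simp: regular_def bounded_measurable_def dest: spec[of _ 0])
next
  case (Suc k)
  have "bounded (Vup V0 (Suc k) ` X)"
    using bounded_up_step[OF Suc] by (simp add: Vup_Suc del: V_up.simps)
  then show ?case
    using assms[unfolded admissible_init_def] by (simp add: regular_def bounded_measurable_def del: V_up.simps)
qed

lemma bounded_measurable_Vup: "admissible V0 \<Longrightarrow> bounded_measurable (Vup V0 k)"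
  using regular_Vup regular_def by blast

text \<open>The offsets \<open>i\<close> and \<open>j\<close> serve two purposes: \<open>1\<close>
  and \<open>0\<close> with one initial function compare consecutive iterates, \<open>0\<close> and
  \<open>0\<close> with two initial functions compare two runs.\<close>

lemma Vup_diff_le:
  assumes V: "admissible V" and W: "admissible W" and x: "x \<in> X"
    and c: "\<And>y. y \<in> X \<Longrightarrow> \<bar>Vup V i y - Vup W j y\<bar> \<le> c"
  shows "\<bar>Vup V (i + k) x - Vup W (j + k) x\<bar> \<le> \<gamma> ^ k * c"
  using x
proof (induction k arbitrary: x)
  case (Suc k)
  then show ?case
    using up_step_contraction[OF regular_Vup[OF V] regular_Vup[OF W] Suc.prems Suc.IH]
    by (simp add: Vup_Suc mult.assoc del: V_up.simps)
qed (simp add: c)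

lemma Vup_ge:
  assumes V: "admissible V" and x: "x \<in> X" and c: "\<And>y. y \<in> X \<Longrightarrow> Vopt y - c \<le> V y"
  shows "Vopt x - \<gamma> ^ k * c \<le> Vup V k x"
  using x
proof (induction k arbitrary: x)
  case (Suc k)
  then show ?case
    using up_step_ge[OF regular_Vup[OF V] Suc.prems Suc.IH]
    by (simp add: Vup_Suc mult.assoc del: V_up.simps)
qed (simp add: c)

text \<open>The constant term is the fixed point of the map sending \<open>e\<close> to
  \<open>\<gamma> * e + 2 * \<gamma> * d\<close>, so the one-step error reproduces it and damps only
  \<open>c\<close>. Nonnegativity of \<open>d\<close> lets the induction start.\<close>

lemma Vup_error:
  assumes V: "admissible V" and x: "x \<in> X"
    and c: "\<And>y. y \<in> X \<Longrightarrow> \<bar>V y - Vopt y\<bar> \<le> c"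
    and d: "\<And>y. y \<in> X \<Longrightarrow> \<bar>V\<pi> y - Vopt y\<bar> \<le> d" "0 \<le> d"
  shows "\<bar>Vup V k x - Vopt x\<bar> \<le> \<gamma> ^ k * c + 2 * \<gamma> / (1 - \<gamma>) * d"
  using x
proof (induction k arbitrary: x)
  case 0
  have "0 \<le> 2 * \<gamma> / (1 - \<gamma>) * d"
    using \<gamma> d(2) by simp
  with c[OF 0] show ?case by simp
next
  case (Suc k)
  have "\<gamma> * (2 * \<gamma> / (1 - \<gamma>) * d) + 2 * \<gamma> * d = 2 * \<gamma> / (1 - \<gamma>) * d"
    using \<gamma> by (simp add: field_simps)
  then show ?case
    using up_step_error[OF regular_Vup[OF V] Suc.prems Suc.IH d(1)]
    by (simp add: Vup_Suc algebra_simps del: V_up.simps)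
qed

text \<open>The increments decay geometrically and uniformly, so the telescoping series converges by
  the Weierstrass M-test.\<close>

lemma Vup_convergent:
  assumes V: "admissible V"
  obtains L where "uniform_limit X (Vup V) L sequentially"
proof -
  obtain c where c: "0 \<le> c" "\<And>x. x \<in> X \<Longrightarrow> \<bar>Vup V 1 x - Vup V 0 x\<bar> \<le> c"
    using bounded_measurableE[OF bounded_measurable_diff[OF bounded_measurable_Vup[OF V] bounded_measurable_Vup[OF V]]]
    by blast
  define f where "f k x = Vup V (Suc k) x - Vup V k x" for k x
  have "norm (f k x) \<le> \<gamma> ^ k * c" if "x \<in> X" for k x
    using Vup_diff_le[OF V V that c(2), of k] by (simp add: f_def del: V_up.simps)
  moreover have "summable (\<lambda>k. \<gamma> ^ k * c)"
    using \<gamma> by (intro summable_mult2 summable_geometric) simp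
  ultimately have "uniform_limit X (\<lambda>n x. \<Sum>k<n. f k x) (\<lambda>x. \<Sum>k. f k x) sequentially"
    by (rule Weierstrass_m_test)
  from uniform_limit_add[OF uniform_limit_const this, of V]
  have "uniform_limit X (\<lambda>n x. V x + (\<Sum>k<n. f k x)) (\<lambda>x. V x + (\<Sum>k. f k x)) sequentially" .
  also have "(\<lambda>n x. V x + (\<Sum>k<n. f k x)) = Vup V"
    by (intro ext) (simp add: f_def sum_lessThan_telescope[of "\<lambda>k. Vup V k _"] del: V_up.simps(2))
  finally show ?thesis by (rule that)
qed

lemma geometric_tendsto_0: "(\<lambda>k. \<gamma> ^ k * c) \<longlonglongrightarrow> 0"
  using \<gamma> by (intro tendsto_mult_left_zero LIMSEQ_power_zero) simp

lemma Vup_limit_unique: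
  assumes V: "admissible V" and W: "admissible W" and L: "uniform_limit X (Vup V) L sequentially"
  shows "uniform_limit X (Vup W) L sequentially"
proof -
  obtain c where c: "\<And>x. x \<in> X \<Longrightarrow> \<bar>Vup W 0 x - Vup V 0 x\<bar> \<le> c"
    using bounded_measurableE[OF bounded_measurable_diff[OF bounded_measurable_Vup[OF W] bounded_measurable_Vup[OF V]]]
    by blast
  have "uniform_limit X (\<lambda>k x. Vup W k x - Vup V k x) (\<lambda>x. 0) sequentially"
  proof (rule uniform_limitI)
    fix e :: real assume "0 < e"
    then have "\<forall>\<^sub>F k in sequentially. \<gamma> ^ k * c < e"
      using geometric_tendsto_0 order_tendstoD(2) by blast
    then show "\<forall>\<^sub>F k in sequentially. \<forall>x\<in>X. dist (Vup W k x - Vup V k x) 0 < e"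
    proof eventually_elim
      case (elim k)
      then show ?case
        using Vup_diff_le[OF W V _ c, of _ k] by (force simp: dist_real_def)
    qed
  qed
  from uniform_limit_add[OF this L] show ?thesis by simp
qed

end

section \<open>Assembly of the four claims\<close>

theorem mainTheorem4:
  fixes M :: "('x, 'a) mdp" and \<gamma> :: real and \<pi> :: "('x, 'a) policy"
    and \<Omega> :: "'x \<Rightarrow> 'w measure" and Y :: "'x \<Rightarrow> 'a \<Rightarrow> 'w \<Rightarrow> 'x"
  assumes "is_mdp M"
    and "bounded_rewards M"
    and "0 < \<gamma>" and "\<gamma> < 1"
    and "\<pi> \<in> policies M"
    and "bellman_optimality M \<gamma> (opt_value M \<gamma>)"
    and "next_state_variables M \<Omega> Y"
  shows
    "(\<exists>V. \<forall>V0. admissible_init M \<gamma> \<pi> \<Omega> Y V0 \<longrightarrow>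
        uniform_limit (state_set M) (V_up M \<gamma> \<pi> \<Omega> Y V0) V sequentially) \<and>
     (\<forall>V0. admissible_init M \<gamma> \<pi> \<Omega> Y V0 \<longrightarrow>
        ((\<forall>x\<in>state_set M. opt_value M \<gamma> x \<le> V0 x) \<longrightarrow>
          (\<forall>k. \<forall>x\<in>state_set M.
             policy_value M \<gamma> \<pi> x \<le> opt_value M \<gamma> x \<and>
             opt_value M \<gamma> x \<le> V_up M \<gamma> \<pi> \<Omega> Y V0 k x)) \<and>
        (\<forall>k. sup_norm (state_set M) (\<lambda>x. V_up M \<gamma> \<pi> \<Omega> Y V0 (Suc k) x - opt_value M \<gamma> x)
             \<le> \<gamma> * sup_norm (state_set M) (\<lambda>x. V_up M \<gamma> \<pi> \<Omega> Y V0 k x - opt_value M \<gamma> x)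
               + 2 * \<gamma> * sup_norm (state_set M) (\<lambda>x. policy_value M \<gamma> \<pi> x - opt_value M \<gamma> x)) \<and>
        (let \<Delta> = (\<lambda>x. opt_value M \<gamma> x - policy_value M \<gamma> \<pi> x);
             \<Delta>up = (\<lambda>x. lim (\<lambda>k. V_up M \<gamma> \<pi> \<Omega> Y V0 k x - policy_value M \<gamma> \<pi> x))
         in sup_norm (state_set M) \<Delta> \<le> sup_norm (state_set M) \<Delta>up \<and>
            sup_norm (state_set M) \<Delta>up
              \<le> (1 + 2 * \<gamma> / (1 - \<gamma>))
                * sup_norm (state_set M) (\<lambda>x. opt_value M \<gamma> x - policy_value M \<gamma> \<pi> x) \<and>
            (optimal_policy M \<gamma> \<pi> \<longrightarrow> (\<forall>x\<in>state_set M. \<Delta>up x = 0))))"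
proof -
  interpret upper_bound_recursion M \<gamma> \<pi> \<Omega> Y
    using assms by (rule upper_bound_recursion.intro)
  obtain d where d: "\<And>x. x \<in> X \<Longrightarrow> \<bar>V\<pi> x - Vopt x\<bar> \<le> d"
    using bounded_measurableE[OF bounded_measurable_diff[OF bounded_measurable_V\<pi> bounded_measurable_Vopt]]
    by blast
  define D where "D = sup_norm X (\<lambda>x. V\<pi> x - Vopt x)"
  have D_commute: "sup_norm X (\<lambda>x. Vopt x - V\<pi> x) = D"
    by (simp add: D_def sup_norm_def abs_minus_commute)
  have D: "\<bar>V\<pi> x - Vopt x\<bar> \<le> D" if "x \<in> X" for x
    unfolding D_def using that d by (rule abs_le_sup_norm)
  have D_nonneg: "0 \<le> D"
    using D nonempty by fastforce
  have convergent: "\<exists>L. \<forall>V0. admissible V0 \<longrightarrow> uniform_limit X (Vup V0) L sequentially"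
  \<comment> \<open>The limit must be chosen before the initial function: any admissible
    \<open>W\<close> provides it, and without one the claim is vacuous.\<close>
  proof (cases "\<exists>W. admissible W")
    case True
    then obtain W L where "admissible W" "uniform_limit X (Vup W) L sequentially"
      using Vup_convergent by metis
    then show ?thesis
      using Vup_limit_unique by blast
  qed auto
  show ?thesis
  proof (intro conjI[OF convergent] allI impI conjI ballI)
    fix V0 k x assume V0: "admissible V0" "\<forall>x\<in>X. Vopt x \<le> V0 x" and x: "x \<in> X"
    show "V\<pi> x \<le> Vopt x"
      by (rule V\<pi>_le_Vopt[OF x])
    show "Vopt x \<le> Vup V0 k x"
      \<comment> \<open>An initial function above \<open>Vopt\<close> has slack 0, which stays
        0.\<close>
      using Vup_ge[OF V0(1) x, of 0 k] V0(2) by simp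
  next
    fix V0 k assume V0: "admissible V0"
    obtain c where c: "\<And>x. x \<in> X \<Longrightarrow> \<bar>Vup V0 k x - Vopt x\<bar> \<le> c"
      using bounded_measurableE[OF bounded_measurable_diff[OF bounded_measurable_Vup[OF V0] bounded_measurable_Vopt]]
      by blast
    show "sup_norm X (\<lambda>x. Vup V0 (Suc k) x - Vopt x)
        \<le> \<gamma> * sup_norm X (\<lambda>x. Vup V0 k x - Vopt x) + 2 * \<gamma> * sup_norm X (\<lambda>x. V\<pi> x - Vopt x)"
      unfolding Vup_Suc D_def[symmetric]
      \<comment> \<open>The one-step error is applied with the sup-norms themselves as constants;
        \<open>c\<close> only certifies that the norm is finite.\<close>
      by (intro sup_norm_le nonempty up_step_error regular_Vup V0 D abs_le_sup_norm[OF _ c])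
  next
    fix V0 assume V0: "admissible V0"
    obtain L where "uniform_limit X (Vup V0) L sequentially"
      using convergent V0 by blast
    then have L: "(\<lambda>k. Vup V0 k x) \<longlonglongrightarrow> L x" if "x \<in> X" for x
      using that by (rule tendsto_uniform_limitI)
    define \<Delta>up where "\<Delta>up x = lim (\<lambda>k. Vup V0 k x - V\<pi> x)" for x
    have \<Delta>up: "\<Delta>up x = L x - V\<pi> x" if "x \<in> X" for x
      unfolding \<Delta>up_def by (intro limI tendsto_intros L that)
    obtain c where c: "\<And>x. x \<in> X \<Longrightarrow> \<bar>V0 x - Vopt x\<bar> \<le> c"
      using bounded_measurableE[OF bounded_measurable_diff[OF bounded_measurable_Vup[OF V0, of 0] bounded_measurable_Vopt]]
      by auto
    \<comment> \<open>The initial function need not lie above \<open>Vopt\<close>: its slack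
      \<open>c\<close> is damped to \<open>\<gamma> ^ k * c\<close>, which vanishes in the
      limit.\<close>
    have le_L: "Vopt x \<le> L x" if x: "x \<in> X" for x
    proof (rule LIMSEQ_le[OF _ L[OF x]])
      show "(\<lambda>k. Vopt x - \<gamma> ^ k * c) \<longlonglongrightarrow> Vopt x"
        using tendsto_diff[OF tendsto_const geometric_tendsto_0] by simp
      have "Vopt y - c \<le> V0 y" if "y \<in> X" for y
        using c[OF that] by linarith
      then show "\<exists>N. \<forall>k\<ge>N. Vopt x - \<gamma> ^ k * c \<le> Vup V0 k x"
        using Vup_ge[OF V0 x] by blast
    qed
    have L_error: "\<bar>L x - Vopt x\<bar> \<le> 2 * \<gamma> / (1 - \<gamma>) * D" if x: "x \<in> X" for x
    proof (rule LIMSEQ_le)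
      show "(\<lambda>k. \<bar>Vup V0 k x - Vopt x\<bar>) \<longlonglongrightarrow> \<bar>L x - Vopt x\<bar>"
        by (intro tendsto_intros L x)
      show "(\<lambda>k. \<gamma> ^ k * c + 2 * \<gamma> / (1 - \<gamma>) * D) \<longlonglongrightarrow> 2 * \<gamma> / (1 - \<gamma>) * D"
        using tendsto_add[OF geometric_tendsto_0 tendsto_const] by simp
      show "\<exists>N. \<forall>k\<ge>N. \<bar>Vup V0 k x - Vopt x\<bar> \<le> \<gamma> ^ k * c + 2 * \<gamma> / (1 - \<gamma>) * D"
        using Vup_error[OF V0 x c D D_nonneg] by blast
    qed
    have \<Delta>up_le: "\<bar>\<Delta>up x\<bar> \<le> (1 + 2 * \<gamma> / (1 - \<gamma>)) * D" if "x \<in> X" for x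
      \<comment> \<open>Triangle inequality through \<open>Vopt\<close>: the summand 1 in the factor
        comes from \<open>Vopt - V\<pi>\<close>, the rest from \<open>L - Vopt\<close>.\<close>
      using L_error[OF that] D[OF that] unfolding \<Delta>up[OF that] distrib_right by linarith
    have "sup_norm X (\<lambda>x. Vopt x - V\<pi> x) \<le> sup_norm X \<Delta>up"
    proof (rule sup_norm_le[OF nonempty(1)])
      fix x assume x: "x \<in> X"
      \<comment> \<open>The ordering of \<open>V\<pi>\<close>, \<open>Vopt\<close> and
        \<open>L\<close> makes both differences nonnegative, so absolute values compare
        directly.\<close>
      have "\<bar>Vopt x - V\<pi> x\<bar> \<le> \<bar>\<Delta>up x\<bar>"
        using V\<pi>_le_Vopt[OF x] le_L[OF x] by (simp add: \<Delta>up[OF x])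
      also have "\<dots> \<le> sup_norm X \<Delta>up"
        using x \<Delta>up_le by (rule abs_le_sup_norm)
      finally show "\<bar>Vopt x - V\<pi> x\<bar> \<le> sup_norm X \<Delta>up" .
    qed
    moreover have "sup_norm X \<Delta>up \<le> (1 + 2 * \<gamma> / (1 - \<gamma>)) * D"
      using nonempty(1) \<Delta>up_le by (rule sup_norm_le)
    moreover have "\<Delta>up x = 0" if "optimal_policy M \<gamma> \<pi>" "x \<in> X" for x
    proof -
      have "D \<le> 0"
        unfolding D_def using that nonempty by (intro sup_norm_le) (auto simp: optimal_policy_def)
      then show ?thesis
        using \<Delta>up_le[OF that(2)] D_nonneg by simp
    qed
    ultimately show "let \<Delta> = (\<lambda>x. Vopt x - V\<pi> x); \<Delta>up = (\<lambda>x. lim (\<lambda>k. Vup V0 k x - V\<pi> x))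
         in sup_norm X \<Delta> \<le> sup_norm X \<Delta>up \<and>
            sup_norm X \<Delta>up \<le> (1 + 2 * \<gamma> / (1 - \<gamma>)) * sup_norm X (\<lambda>x. Vopt x - V\<pi> x) \<and>
            (optimal_policy M \<gamma> \<pi> \<longrightarrow> (\<forall>x\<in>X. \<Delta>up x = 0))"
      unfolding Let_def \<Delta>up_def[abs_def, symmetric] D_commute by blast
  qed
qed

end
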